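(* Let $G=(V,E)$ be a graph with $n=|V|$ vertices and $m=|E|$ edges, let $k$ be an integer with $0\le k\le n$, and let ${\bf s}^{(1)}$ be the string associated to $G$ as described in the context. Then $G$ has a vertex cover of size $k$ if and only if there exists a $1$-BLZ parsing of ${\bf s}^{(1)}$ of size $4n+6m+k$.
   Context: Strings: for ${\bf s}=s_1\dots s_N$ and $1\le i\le j\le N$, ${\bf s}[i,j]=s_i\dots s_j$. A parsing of ${\bf s}$ is a partition of ${\bf s}$ into consecutive nonempty substrings called phrases; its size is the number of phrases. An LZ-parsing is a parsing in which every phrase ${\bf s}[a,e]$ either has length $1$, or is given together with a chosen source start $b$ with $1\le b\le a-1$ and ${\bf s}[b,b+(e-a)-1]={\bf s}[a,e-1]$ (the source may overlap the phrase). For such a phrase, each position $a+t$ with $0\le t\le e-a-1$ has source position $b+(t \bmod (a-b))$. The hop-number of a position $p$ is $hop(p)=0$ if $p$ is the last position of a phrase, and $hop(p)=hop(q)+1$ where $q<p$ is the source position of $p$ otherwise. A $c$-BLZ parsing is an LZ-parsing in which every position has hop-number at most $c$. Construction: $G=(V,E)$ is a simple undirected graph with $V=\{v_1,\dots,v_n\}$, $E=\{e_1,\dots,e_m\}$; for each edge $e_i$ fix an ordering $(v_p,v_q)$ of its endpoints. Use pairwise distinct symbols $v_i,v_i',\#^v_i$ ($i\in[n]$), $e_i,\$_i,\#^e_i$ ($i\in[m]$), $\#^p_t$ ($t\in[n+m]$). Define $P=v_1\#^p_1 v_2\#^p_2\cdots v_n\#^p_n e_1\#^p_{n+1}e_2\#^p_{n+2}\cdots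 e_m\#^p_{n+m}$; $X_i=v_i'\,v_i\,\#^v_i$ and $X=X_1X_2\cdots X_n$; for $e_i=(v_p,v_q)$, $Y_i=v_p'\,v_p\,e_i\,\$_i\,v_q'\,v_q\,e_i\,\$_i\,\#^e_i$ and $Y=Y_1\cdots Y_m$; finally ${\bf s}^{(1)}=PXY$. A vertex cover of $G$ is a set $C\subseteq V$ meeting every edge. *)

theory Defs
  imports Main
begin

text \<open>Positions in strings are counted from 1.\<close>

definition substring :: "'a list \<Rightarrow> nat \<Rightarrow> nat \<Rightarrow> 'a list" where
  "substring s i j = take (Suc j - i) (drop (i - 1) s)"

text \<open>A phrase carries its first position, its last position and, optionally, the first
  position of its chosen source.\<close>

datatype phrase = Phrase (first: nat) (final: nat) (source: "nat option")

fun tiles :: "nat \<Rightarrow> nat \<Rightarrow> phrase list \<Rightarrow> bool" where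
  "tiles i N [] \<longleftrightarrow> i = Suc N"
| "tiles i N (ph # phs) \<longleftrightarrow> first ph = i \<and> i \<le> final ph \<and> tiles (Suc (final ph)) N phs"

definition parsing :: "'a list \<Rightarrow> phrase list \<Rightarrow> bool" where
  "parsing s phs \<longleftrightarrow> tiles 1 (length s) phs"

text \<open>The last symbol of a phrase need not be copied, so only the positions before it have to
  match the source. The source of a phrase of length 1, if present, is irrelevant.\<close>

definition LZ_phrase :: "'a list \<Rightarrow> phrase \<Rightarrow> bool" where
  "LZ_phrase s ph \<longleftrightarrow>
     (case source ph of
        None \<Rightarrow> first ph = final ph
      | Some b \<Rightarrow> 1 \<le> b \<and> b \<le> first ph - 1 \<and>
          substring s b (b + (final ph - first ph) - 1) = substring s (first ph) (final ph - 1))"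

definition LZ_parsing :: "'a list \<Rightarrow> phrase list \<Rightarrow> bool" where
  "LZ_parsing s phs \<longleftrightarrow> parsing s phs \<and> (\<forall>ph\<in>set phs. LZ_phrase s ph)"

definition source_pos :: "phrase list \<Rightarrow> nat \<Rightarrow> nat option" where
  "source_pos phs p =
     (case find (\<lambda>ph. first ph \<le> p \<and> p \<le> final ph) phs of
        None \<Rightarrow> None
      | Some ph \<Rightarrow>
          if p = final ph then None
          else map_option (\<lambda>b. b + (p - first ph) mod (first ph - b)) (source ph))"

text \<open>The test \<open>q < p\<close> only makes the recursion total: by \<open>hop_copied\<close> below it always
  succeeds in an LZ-parsing.\<close>

function hop :: "phrase list \<Rightarrow> nat \<Rightarrow> nat" where
  "hop phs p =
     (case source_pos phs p of
        None \<Rightarrow> 0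
      | Some q \<Rightarrow> if q < p then Suc (hop phs q) else 0)"
  by pat_completeness auto
termination by (relation "measure snd") auto

declare hop.simps [simp del]

definition BLZ_parsing :: "nat \<Rightarrow> 'a list \<Rightarrow> phrase list \<Rightarrow> bool" where
  "BLZ_parsing c s phs \<longleftrightarrow> LZ_parsing s phs \<and> (\<forall>p\<in>{1..length s}. hop phs p \<le> c)"

lemma tiles_first_ge: "tiles i N phs \<Longrightarrow> ph \<in> set phs \<Longrightarrow> i \<le> first ph \<and> first ph \<le> final ph"
  by (induction phs arbitrary: i) force+

lemma find_phrase:
  assumes "tiles i N phs" "ph \<in> set phs" "first ph \<le> p" "p \<le> final ph"
  shows "find (\<lambda>ph. first ph \<le> p \<and> p \<le> final ph) phs = Some ph"
  using assms
proof (induction phs arbitrary: i)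
  case (Cons a phs)
  show ?case
  proof (cases "ph = a")
    case False
    then have "ph \<in> set phs" "tiles (Suc (final a)) N phs"
      using Cons.prems by auto
    moreover from this have "Suc (final a) \<le> p"
      using tiles_first_ge Cons.prems(3) order_trans by blast
    ultimately show ?thesis using Cons by auto
  qed (use Cons.prems in simp)
qed simp

lemma hop_final:
  assumes "LZ_parsing s phs" "ph \<in> set phs"
  shows "hop phs (final ph) = 0"
proof -
  have t: "tiles 1 (length s) phs"
    using assms by (simp add: LZ_parsing_def parsing_def)
  have "first ph \<le> final ph"
    using tiles_first_ge [OF t assms(2)] by simp
  then have "source_pos phs (final ph) = None"
    using find_phrase [OF t assms(2)] by (simp add: source_pos_def)
  then show ?thesis
    by (simp add: hop.simps)
qed

lemma hop_copied:
  assumes "LZ_parsing s phs" "Phrase a e src \<in> set phs" "t < e - a"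
  obtains b where "src = Some b" "b + t mod (a - b) < a + t"
    "hop phs (a + t) = Suc (hop phs (b + t mod (a - b)))"
proof -
  have t: "tiles 1 (length s) phs" and L: "LZ_phrase s (Phrase a e src)"
    using assms by (auto simp: LZ_parsing_def parsing_def)
  obtain b where b: "src = Some b" "1 \<le> b" "b \<le> a - 1"
    using L assms(3) by (auto simp: LZ_phrase_def split: option.splits)
  have lt: "b + t mod (a - b) < a + t"
  proof -
    have "t mod (a - b) < a - b" using b by simp
    then show ?thesis by linarith
  qed
  have "source_pos phs (a + t) = Some (b + t mod (a - b))"
    using find_phrase [OF t assms(2), of "a + t"] assms(3) b by (simp add: source_pos_def)
  then have "hop phs (a + t) = Suc (hop phs (b + t mod (a - b)))"
    using lt by (simp add: hop.simps [of phs "a + t"])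
  then show thesis using that b lt by blast
qed

definition simple_graph :: "'v set \<Rightarrow> 'v set set \<Rightarrow> bool" where
  "simple_graph V E \<longleftrightarrow> finite V \<and> (\<forall>e\<in>E. e \<subseteq> V \<and> card e = 2)"

definition vertex_cover :: "'v set \<Rightarrow> 'v set set \<Rightarrow> 'v set \<Rightarrow> bool" where
  "vertex_cover V E C \<longleftrightarrow> C \<subseteq> V \<and> (\<forall>e\<in>E. C \<inter> e \<noteq> {})"

text \<open>The symbols $v_i$, $v_i'$, $\#^v_i$, $e_i$, $\$_i$, $\#^e_i$ and $\#^p_t$.\<close>

datatype symbol =
    Vtx nat | Vtx' nat | HashV nat | Edge nat | Dollar nat | HashE nat | HashP nat

definition string_P :: "nat \<Rightarrow> nat \<Rightarrow> symbol list" where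
  "string_P n m =
     concat (map (\<lambda>i. [Vtx i, HashP i]) [1..<Suc n]) @
     concat (map (\<lambda>i. [Edge i, HashP (n + i)]) [1..<Suc m])"

definition string_X :: "nat \<Rightarrow> symbol list" where
  "string_X n = concat (map (\<lambda>i. [Vtx' i, Vtx i, HashV i]) [1..<Suc n])"

text \<open>\<open>ends i = (p, q)\<close> means that \<open>(v\<^sub>p, v\<^sub>q)\<close> is the chosen ordering of the endpoints
  of the edge \<open>e\<^sub>i\<close>.\<close>

definition string_Y :: "nat \<Rightarrow> (nat \<Rightarrow> nat \<times> nat) \<Rightarrow> symbol list" where
  "string_Y m ends =
     concat (map (\<lambda>i. case ends i of (p, q) \<Rightarrow>
       [Vtx' p, Vtx p, Edge i, Dollar i, Vtx' q, Vtx q, Edge i, Dollar i, HashE i]) [1..<Suc m])"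

definition string_s1 :: "nat \<Rightarrow> nat \<Rightarrow> (nat \<Rightarrow> nat \<times> nat) \<Rightarrow> symbol list" where
  "string_s1 n m ends = string_P n m @ string_X n @ string_Y m ends"

end

theory Submission
  imports Defs
begin

text \<open>In a 1-BLZ parsing every copied position has a source that ends a phrase, so a parsing is
  governed by its set of final positions, whose cardinality is the size. Positions with a fresh
  symbol are final; this forces \<open>2n + 2m\<close> phrases in \<open>P\<close> and two phrases in each \<open>X\<^sub>i\<close>, a third one
  occurring exactly when the symbol \<open>v\<^sub>i\<close> of \<open>X\<^sub>i\<close> is final. Since \<open>v\<^sub>p e\<^sub>j\<close> and \<open>v\<^sub>q e\<^sub>j\<close> are fresh,
  each half of \<open>Y\<^sub>j\<close> needs two phrases. With only four phrases the two halves cannot both be cut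
  before \<open>e\<^sub>j\<close>: the second \<open>e\<^sub>j $\<^sub>j\<close> would then be copied from the first one, whose \<open>e\<^sub>j\<close> is not
  final. Hence \<open>v\<^sub>r' v\<^sub>r\<close> is copied for an endpoint \<open>r\<close> of \<open>e\<^sub>j\<close>, from two final positions. They lie
  in \<open>X\<^sub>r\<close>, or in an earlier half of some \<open>Y\<^sub>l\<close>, which then costs an extra phrase of its own. So the
  vertices paid for by extra phrases form a vertex cover.\<close>

section \<open>Final positions of a parsing\<close>

abbreviation finals :: "phrase list \<Rightarrow> nat set" where
  "finals phs \<equiv> final ` set phs"

lemma tiles_append: "tiles i M phs \<Longrightarrow> tiles (Suc M) N phs' \<Longrightarrow> tiles i N (phs @ phs')"
  by (induction phs arbitrary: i) auto

text \<open>Lets a parsing be assembled blockwise: block \<open>i\<close> occupies the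
  \<open>l\<close> positions after \<open>c + (i - 1) * l\<close>.\<close>

lemma tiles_blocks:
  assumes "\<And>i. i \<in> {1..r} \<Longrightarrow> tiles (Suc (c + (i - 1) * l)) (c + i * l) (f i)"
  shows "tiles (Suc c) (c + r * l) (concat (map f [1..<Suc r]))"
  using assms
proof (induction r)
  case (Suc r)
  then have "tiles (Suc c) (c + r * l) (concat (map f [1..<Suc r]))"
    and "tiles (Suc (c + r * l)) (c + Suc r * l) (f (Suc r))"
    using Suc.prems [of "Suc r"] by auto
  then show ?case
    by (simp add: tiles_append)
qed simp

lemma tiles_le: "tiles i N phs \<Longrightarrow> i \<le> Suc N"
  by (induction phs arbitrary: i) force+

lemma finals_subset: "tiles i N phs \<Longrightarrow> finals phs \<subseteq> {i..N}"
proof (induction phs arbitrary: i)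
  case (Cons ph phs)
  then have "finals phs \<subseteq> {Suc (final ph)..N}" "i \<le> final ph" "tiles (Suc (final ph)) N phs"
    by auto
  moreover from this have "final ph \<le> N"
    using tiles_le [of "Suc (final ph)"] by simp
  ultimately show ?case by auto
qed simp

text \<open>Later phrases end strictly later, so no two phrases of a tiling share an end. The size
  of a parsing thus becomes a cardinality that can be split over disjoint blocks.\<close>

lemma card_finals: "tiles i N phs \<Longrightarrow> card (finals phs) = length phs"
proof (induction phs arbitrary: i)
  case (Cons ph phs)
  then have "final ph \<notin> finals phs"
    using finals_subset [of "Suc (final ph)" N phs] by auto
  moreover have "card (finals phs) = length phs"
    using Cons.IH [of "Suc (final ph)"] Cons.prems by simp
  ultimately show ?case by simp
qed simp

lemma tiles_cover:
  "tiles i N phs \<Longrightarrow> i \<le> p \<Longrightarrow> p \<le> N \<Longrightarrow> \<exists>ph\<in>set phs. first ph \<le> p \<and> p \<le> final ph"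
proof (induction phs arbitrary: i)
  case (Cons ph phs)
  show ?case
  proof (cases "p \<le> final ph")
    case False
    then show ?thesis using Cons.IH [of "Suc (final ph)"] Cons.prems by auto
  qed (use Cons.prems in auto)
qed simp

lemma tiles_unique:
  assumes "tiles i N phs" "ph \<in> set phs" "ph' \<in> set phs"
    and "first ph \<le> p" "p \<le> final ph" "first ph' \<le> p" "p \<le> final ph'"
  shows "ph = ph'"
  using find_phrase [of i N phs ph p] find_phrase [of i N phs ph' p] assms by simp

text \<open>Translates 1-based positions into the 0-based \<open>!\<close>, hence the
  \<open>- 1\<close>; the bounds keep \<open>take\<close> from being cut short at the end of
  \<open>s\<close>.\<close>

lemma substring_eq_iff:
  assumes "1 \<le> a" "1 \<le> b" "a + l \<le> Suc (length s)" "b + l \<le> Suc (length s)"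
  shows "substring s b (b + l - 1) = substring s a (a + l - 1) \<longleftrightarrow>
    (\<forall>u<l. s ! (b + u - 1) = s ! (a + u - 1))"
proof -
  have *: "substring s c (c + l - 1) = map (\<lambda>u. s ! (c + u - 1)) [0..<l]"
    if "1 \<le> c" "c + l \<le> Suc (length s)" for c
    using that by (intro nth_equalityI) (auto simp: substring_def)
  show ?thesis
    using assms by (simp add: * del: One_nat_def) (auto simp del: One_nat_def)
qed

lemma LZ_phrase_copy:
  assumes "1 \<le> b" "b < a" "a \<le> e" "e \<le> length s"
  shows "LZ_phrase s (Phrase a e (Some b)) \<longleftrightarrow>
    (\<forall>u<e - a. s ! (b + u - 1) = s ! (a + u - 1))"
proof -
  have "a + (e - a) - 1 = e - 1" using assms by simp
  then show ?thesis
    using substring_eq_iff [of a b "e - a" s] assms by (auto simp: LZ_phrase_def)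
qed

text \<open>Converse of \<open>hop_final\<close>: before the end of a phrase,
  \<open>hop_copied\<close> makes the hop-number a successor.\<close>

lemma final_if_hop_0:
  assumes "LZ_parsing s phs" "p \<in> {1..length s}" "hop phs p = 0"
  shows "p \<in> finals phs"
proof -
  have "tiles 1 (length s) phs"
    using assms by (simp add: LZ_parsing_def parsing_def)
  then obtain a e src where ph: "Phrase a e src \<in> set phs" "a \<le> p" "p \<le> e"
    using tiles_cover [of 1 "length s" phs p] assms(2) by (metis atLeastAtMost_iff phrase.collapse)
  show ?thesis
  proof (cases "p = e")
    case True
    with ph show ?thesis by force
  next
    case False
    then have "p - a < e - a" "a + (p - a) = p" using ph by auto
    with hop_copied [OF assms(1) ph(1), of "p - a"] assms(3) show ?thesis
      by (metis nat.distinct(1))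
  qed
qed

text \<open>Final sources have hop-number 0 by \<open>hop_final\<close>, so every copied position
  gets hop-number 1.\<close>

lemma BLZ_parsing_1I:
  assumes LZ: "LZ_parsing s phs"
    and src: "\<And>a e b t. Phrase a e (Some b) \<in> set phs \<Longrightarrow> t < e - a \<Longrightarrow>
      b + t mod (a - b) \<in> finals phs"
  shows "BLZ_parsing 1 s phs"
  unfolding BLZ_parsing_def
proof (intro conjI LZ ballI)
  fix p assume p: "p \<in> {1..length s}"
  have "tiles 1 (length s) phs"
    using LZ by (simp add: LZ_parsing_def parsing_def)
  then obtain a e src' where ph: "Phrase a e src' \<in> set phs" "a \<le> p" "p \<le> e"
    using tiles_cover [of 1 "length s" phs p] p by (metis atLeastAtMost_iff phrase.collapse)
  show "hop phs p \<le> 1"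
  proof (cases "p = e")
    case True
    then show ?thesis using hop_final [OF LZ ph(1)] by simp
  next
    case False
    then have t: "p - a < e - a" "a + (p - a) = p" using ph by auto
    obtain b where "src' = Some b" "hop phs p = Suc (hop phs (b + (p - a) mod (a - b)))"
      using hop_copied [OF LZ ph(1) t(1)] t(2) by metis
    moreover from this have "b + (p - a) mod (a - b) \<in> finals phs"
      using src ph(1) t(1) by blast
    ultimately show ?thesis
      using hop_final [OF LZ] by auto
  qed
qed

section \<open>Copied positions in a 1-BLZ parsing\<close>

context
  fixes s :: "'a list" and phs :: "phrase list"
  assumes BLZ: "BLZ_parsing 1 s phs"
begin

lemma BLZ_tiles: "tiles 1 (length s) phs"
  using BLZ by (simp add: BLZ_parsing_def LZ_parsing_def parsing_def)

text \<open>A copied position has hop-number one more than its source, so the bound 1 leaves 0 for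
  the source, which is then final. Symbols are compared along the plain shift \<open>b + u\<close>,
  which may reach into the phrase itself, whereas finality concerns the reduced source
  \<open>b + u mod (a - b)\<close>.\<close>

lemma nonfinal_source:
  assumes p: "p \<in> {1..length s}" "p \<notin> finals phs"
  obtains a e b where "Phrase a e (Some b) \<in> set phs" "a \<le> p" "p < e" "e \<le> length s"
    "1 \<le> b" "b < a"
    "\<And>u. u < e - a \<Longrightarrow> s ! (b + u - 1) = s ! (a + u - 1)"
    "\<And>u. u < e - a \<Longrightarrow> b + u mod (a - b) \<in> finals phs"
proof -
  have LZ: "LZ_parsing s phs" using BLZ by (simp add: BLZ_parsing_def)
  obtain a e src where ph: "Phrase a e src \<in> set phs" "a \<le> p" "p \<le> e"
    using tiles_cover [OF BLZ_tiles, of p] p by (metis atLeastAtMost_iff phrase.collapse)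
  have "e \<in> finals phs"
    using ph(1) by force
  then have e: "p < e" "e \<le> length s"
    using p ph finals_subset [OF BLZ_tiles] by (auto simp: order.order_iff_strict)
  have L: "LZ_phrase s (Phrase a e src)"
    using LZ ph(1) by (simp add: LZ_parsing_def)
  then obtain b where b: "src = Some b" "1 \<le> b" "b < a"
    using ph e by (auto simp: LZ_phrase_def split: option.splits)
  have "b + u mod (a - b) \<in> finals phs" if u: "u < e - a" for u
  proof -
    have "a + u \<in> {1..length s}" using u b e by auto
    then have "hop phs (a + u) \<le> 1"
      using BLZ unfolding BLZ_parsing_def by blast
    then have "hop phs (b + u mod (a - b)) = 0" "b + u mod (a - b) < a + u"
      using hop_copied [OF LZ ph(1) u] b(1) by (metis One_nat_def Suc_le_mono le_zero_eq option.inject)+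
    then show ?thesis
      using final_if_hop_0 [OF LZ] \<open>a + u \<in> _\<close> b by simp
  qed
  moreover have "s ! (b + u - 1) = s ! (a + u - 1)" if "u < e - a" for u
    using L LZ_phrase_copy [of b a e s] that b ph e by simp
  ultimately show thesis
    using that ph e b by blast
qed

lemma nonfinal_occurs:
  assumes "p \<in> {1..length s}" "p \<notin> finals phs"
  obtains q where "1 \<le> q" "q < p" "s ! (q - 1) = s ! (p - 1)"
proof -
  obtain a e b where "a \<le> p" "p < e" "1 \<le> b" "b < a"
    and eq: "\<And>u. u < e - a \<Longrightarrow> s ! (b + u - 1) = s ! (a + u - 1)"
    using nonfinal_source [OF assms] by metis
  then show thesis
    using that [of "b + (p - a)"] eq [of "p - a"] by auto
qed

text \<open>Neither \<open>p\<close> nor \<open>Suc p\<close> ends a phrase, so a single phrase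
  copies both symbols by the same shift.\<close>

lemma nonfinal2_occurs:
  assumes "p \<in> {1..length s}" "p \<notin> finals phs" "Suc p \<notin> finals phs"
  obtains q where "1 \<le> q" "q < p" "s ! (q - 1) = s ! (p - 1)" "s ! q = s ! p"
proof -
  obtain a e b where ph: "Phrase a e (Some b) \<in> set phs" "a \<le> p" "p < e" "1 \<le> b" "b < a"
    and eq: "\<And>u. u < e - a \<Longrightarrow> s ! (b + u - 1) = s ! (a + u - 1)"
    using nonfinal_source [OF assms(1,2)] by metis
  have "e \<noteq> Suc p" using ph(1) assms(3) by force
  then show thesis
    using that [of "b + (p - a)"] eq [of "p - a"] eq [of "Suc p - a"] ph
    by (auto simp: Suc_diff_le)
qed

text \<open>Here the phrase starts at \<open>Suc p\<close>; as its first two symbols differ, its period is at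
  least 2, so the sources of these two positions are adjacent.\<close>

lemma nonfinal2_final_source:
  assumes "Suc p \<in> {1..length s}" "p = 0 \<or> p \<in> finals phs"
    and "Suc p \<notin> finals phs" "Suc (Suc p) \<notin> finals phs" "s ! p \<noteq> s ! Suc p"
  obtains q where "1 \<le> q" "Suc q \<le> p" "q \<in> finals phs" "Suc q \<in> finals phs"
    "s ! (q - 1) = s ! p" "s ! q = s ! Suc p"
proof -
  obtain a e b where ph: "Phrase a e (Some b) \<in> set phs" "a \<le> Suc p" "Suc p < e" "1 \<le> b" "b < a"
    and eq: "\<And>u. u < e - a \<Longrightarrow> s ! (b + u - 1) = s ! (a + u - 1)"
    and src: "\<And>u. u < e - a \<Longrightarrow> b + u mod (a - b) \<in> finals phs"
    using nonfinal_source [OF assms(1,3)] by metis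
  \<comment> \<open>A phrase starting earlier would also contain \<open>p\<close>, where a different
    phrase ends; for \<open>p = 0\<close> there is no room for a source.\<close>
  have a: "a = Suc p"
  proof (rule ccontr)
    assume "a \<noteq> Suc p"
    then have ap: "a \<le> p" using ph by simp
    then obtain ph' where ph': "ph' \<in> set phs" "final ph' = p"
      using assms(2) ph by auto
    have "Phrase a e (Some b) = ph'"
      using tiles_unique [OF BLZ_tiles ph(1) ph'(1), of p] tiles_first_ge [OF BLZ_tiles ph'(1)]
        ap ph ph' by simp
    then show False using ph' ph by auto
  qed
  have e: "e \<noteq> Suc (Suc p)" using ph(1) assms(4) by force
  have sb: "s ! (b - 1) = s ! p" "s ! b = s ! Suc p"
    using eq [of 0] eq [of 1] a e ph by auto
  have "b \<noteq> p" using sb assms(5) by auto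
  then show thesis
    using that [of b] sb src [of 0] src [of 1] a e ph by (auto simp: Suc_diff_le)
qed

end

section \<open>Strings made of blocks of equal length\<close>

lemma length_concat_blocks:
  assumes "\<And>i. i \<in> {1..r} \<Longrightarrow> length (f i) = l"
  shows "length (concat (map f [1..<Suc r])) = r * l"
  using assms by (induction r) auto

lemma nth_concat_blocks:
  assumes "\<And>i. i \<in> {1..r} \<Longrightarrow> length (f i) = l" "i \<in> {1..r}" "t < l"
  shows "concat (map f [1..<Suc r]) ! ((i - 1) * l + t) = f i ! t"
  using assms
proof (induction r)
  case (Suc r)
  have len: "length (concat (map f [1..<Suc r])) = r * l"
    using Suc.prems(1) by (intro length_concat_blocks) auto
  show ?case
  proof (cases "i = Suc r")
    case True
    then show ?thesis using len by (simp add: nth_append)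
  next
    case False
    then have i: "i \<in> {1..r}" using Suc.prems(2) by auto
    then have "(i - 1) * l + t < i * l"
      using Suc.prems(3) by (cases i) auto
    also have "\<dots> \<le> r * l" using i by simp
    finally have "concat (map f [1..<Suc (Suc r)]) ! ((i - 1) * l + t)
        = concat (map f [1..<Suc r]) ! ((i - 1) * l + t)"
      using len by (simp add: nth_append)
    then show ?thesis using Suc.IH Suc.prems i by auto
  qed
qed simp

text \<open>Division of \<open>p - 1\<close> by \<open>l\<close> yields the block and the offset;
  the shift by 1 is due to positions starting at 1.\<close>

lemma block_position:
  fixes p r l :: nat
  assumes "p \<in> {1..r * l}"
  obtains i t where "i \<in> {1..r}" "t < l" "p = (i - 1) * l + t + 1"
proof -
  have "0 < l" using assms by (cases l) auto
  moreover have "(p - 1) div l < r"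
    using assms \<open>0 < l\<close> by (subst div_less_iff_less_mult) auto
  moreover have "p = (p - 1) div l * l + (p - 1) mod l + 1"
    using assms by (subst div_mult_mod_eq) simp
  ultimately show thesis
    using that [of "Suc ((p - 1) div l)" "(p - 1) mod l"] by auto
qed

text \<open>Left-open intervals make consecutive blocks adjacent and disjoint, so their counts
  simply add up.\<close>

lemma card_blocks:
  fixes c r l :: nat
  shows "card (A \<inter> {c<..c + r * l}) = (\<Sum>i\<in>{1..r}. card (A \<inter> {c + (i - 1) * l<..c + i * l}))"
proof (induction r)
  case (Suc r)
  have "A \<inter> {c<..c + Suc r * l} = (A \<inter> {c<..c + r * l}) \<union> (A \<inter> {c + r * l<..c + Suc r * l})"
    by auto
  also have "card \<dots> = card (A \<inter> {c<..c + r * l}) + card (A \<inter> {c + r * l<..c + Suc r * l})"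
    by (rule card_Un_disjoint) auto
  finally show ?case using Suc.IH by simp
qed simp

text \<open>As a rewrite rule this turns the count over an explicitly listed block into a sum of
  indicators.\<close>

lemma card_Int_insert:
  "finite B \<Longrightarrow> b \<notin> B \<Longrightarrow> card (A \<inter> insert b B) = of_bool (b \<in> A) + card (A \<inter> B)"
  by simp

section \<open>The symbols of the reduction string\<close>

text \<open>The graph is represented by indices only; distinct endpoints express that there are no
  loops.\<close>

locale reduction =
  fixes n m :: nat and ends :: "nat \<Rightarrow> nat \<times> nat"
  assumes ends: "j \<in> {1..m} \<Longrightarrow>
    fst (ends j) \<in> {1..n} \<and> snd (ends j) \<in> {1..n} \<and> fst (ends j) \<noteq> snd (ends j)"
begin

abbreviation s :: "symbol list" where
  "s \<equiv> string_s1 n m ends"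

text \<open>An offset is the position just before a block, so the block's symbols follow at distance
  1, 2, and so on. Here \<open>2 * n + 2 * m\<close> is the length of \<open>P\<close>; in
  \<open>yoff\<close>, \<open>5 * n + 2 * m\<close> is that of \<open>P X\<close>.\<close>

definition xoff :: "nat \<Rightarrow> nat" where
  "xoff i = 2 * n + 2 * m + 3 * (i - 1)"

definition yoff :: "nat \<Rightarrow> nat" where
  "yoff j = 5 * n + 2 * m + 9 * (j - 1)"

text \<open>The string as a table of positions and symbols. Rule inversion at a fixed symbol lists
  all its occurrences, which is what the freshness arguments need.\<close>

inductive occ :: "nat \<Rightarrow> symbol \<Rightarrow> bool" where
  PV: "i \<in> {1..n} \<Longrightarrow> occ (2 * i - 1) (Vtx i)"
| PVH: "i \<in> {1..n} \<Longrightarrow> occ (2 * i) (HashP i)"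
| PE: "j \<in> {1..m} \<Longrightarrow> occ (2 * n + 2 * j - 1) (Edge j)"
| PEH: "j \<in> {1..m} \<Longrightarrow> occ (2 * n + 2 * j) (HashP (n + j))"
| X1: "i \<in> {1..n} \<Longrightarrow> occ (xoff i + 1) (Vtx' i)"
| X2: "i \<in> {1..n} \<Longrightarrow> occ (xoff i + 2) (Vtx i)"
| X3: "i \<in> {1..n} \<Longrightarrow> occ (xoff i + 3) (HashV i)"
| Y1: "j \<in> {1..m} \<Longrightarrow> occ (yoff j + 1) (Vtx' (fst (ends j)))"
| Y2: "j \<in> {1..m} \<Longrightarrow> occ (yoff j + 2) (Vtx (fst (ends j)))"
| Y3: "j \<in> {1..m} \<Longrightarrow> occ (yoff j + 3) (Edge j)"
| Y4: "j \<in> {1..m} \<Longrightarrow> occ (yoff j + 4) (Dollar j)"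
| Y5: "j \<in> {1..m} \<Longrightarrow> occ (yoff j + 5) (Vtx' (snd (ends j)))"
| Y6: "j \<in> {1..m} \<Longrightarrow> occ (yoff j + 6) (Vtx (snd (ends j)))"
| Y7: "j \<in> {1..m} \<Longrightarrow> occ (yoff j + 7) (Edge j)"
| Y8: "j \<in> {1..m} \<Longrightarrow> occ (yoff j + 8) (Dollar j)"
| Y9: "j \<in> {1..m} \<Longrightarrow> occ (yoff j + 9) (HashE j)"

lemma length_s: "length s = 5 * n + 11 * m"
  unfolding string_s1_def string_P_def string_X_def string_Y_def
  using length_concat_blocks [of n "\<lambda>i. [Vtx i, HashP i]" 2]
    length_concat_blocks [of m "\<lambda>i. [Edge i, HashP (n + i)]" 2]
    length_concat_blocks [of n "\<lambda>i. [Vtx' i, Vtx i, HashV i]" 3]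
    length_concat_blocks [of m "\<lambda>i. case ends i of (p, q) \<Rightarrow> [Vtx' p, Vtx p, Edge i, Dollar i,
      Vtx' q, Vtx q, Edge i, Dollar i, HashE i]" 9]
  by (simp add: case_prod_beta del: upt_Suc)

lemma nth_s:
  shows "i \<in> {1..n} \<Longrightarrow> t < 2 \<Longrightarrow> s ! ((i - 1) * 2 + t) = [Vtx i, HashP i] ! t"
    and "j \<in> {1..m} \<Longrightarrow> t < 2 \<Longrightarrow> s ! (2 * n + (j - 1) * 2 + t) = [Edge j, HashP (n + j)] ! t"
    and "i \<in> {1..n} \<Longrightarrow> t < 3 \<Longrightarrow> s ! (xoff i + t) = [Vtx' i, Vtx i, HashV i] ! t"
    and "j \<in> {1..m} \<Longrightarrow> t < 9 \<Longrightarrow> s ! (yoff j + t) = (case ends j of (p, q) \<Rightarrow>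
      [Vtx' p, Vtx p, Edge j, Dollar j, Vtx' q, Vtx q, Edge j, Dollar j, HashE j]) ! t"
proof -
  define f g h where "f = (\<lambda>i. [Vtx i, HashP i])" and "g = (\<lambda>i. [Edge i, HashP (n + i)])"
    and "h = (\<lambda>i. [Vtx' i, Vtx i, HashV i])"
  define k where "k = (\<lambda>i. case ends i of (p, q) \<Rightarrow> [Vtx' p, Vtx p, Edge i, Dollar i,
      Vtx' q, Vtx q, Edge i, Dollar i, HashE i])"
  \<comment> \<open>Keeping the four concatenations opaque leaves only their lengths for
    \<open>nth_append\<close> to work with.\<close>
  define f' g' h' k' where "f' = concat (map f [1..<Suc n])" and "g' = concat (map g [1..<Suc m])"
    and "h' = concat (map h [1..<Suc n])" and "k' = concat (map k [1..<Suc m])"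
  note defs' = f'_def g'_def h'_def k'_def
  have s: "s = f' @ g' @ h' @ k'"
    by (simp add: string_s1_def string_P_def string_X_def string_Y_def f_def g_def h_def k_def
        defs' del: upt_Suc)
  have l: "length (f i) = 2" "length (g i) = 2" "length (h i) = 3" "length (k i) = 9" for i
    by (simp_all add: f_def g_def h_def k_def case_prod_beta)
  note L = length_concat_blocks [of n f 2, OF l(1), folded defs']
    length_concat_blocks [of m g 2, OF l(2), folded defs']
    length_concat_blocks [of n h 3, OF l(3), folded defs']
  note N = nth_concat_blocks [of n f 2, OF l(1), folded defs']
    nth_concat_blocks [of m g 2, OF l(2), folded defs']
    nth_concat_blocks [of n h 3, OF l(3), folded defs']
    nth_concat_blocks [of m k 9, OF l(4), folded defs']
  show "s ! ((i - 1) * 2 + t) = [Vtx i, HashP i] ! t" if "i \<in> {1..n}" "t < 2"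
  proof -
    have "(i - 1) * 2 + t < n * 2" using that by auto
    then have "s ! ((i - 1) * 2 + t) = f' ! ((i - 1) * 2 + t)"
      unfolding s by (simp only: nth_append L if_True)
    then show ?thesis using N(1) [OF that] by (simp add: f_def)
  qed
  show "s ! (2 * n + (j - 1) * 2 + t) = [Edge j, HashP (n + j)] ! t" if "j \<in> {1..m}" "t < 2"
  proof -
    have "(j - 1) * 2 + t < m * 2" using that by auto
    then have "s ! (n * 2 + ((j - 1) * 2 + t)) = g' ! ((j - 1) * 2 + t)"
      unfolding s by (simp add: nth_append L)
    then show ?thesis using N(2) [OF that] by (simp add: g_def algebra_simps)
  qed
  show "s ! (xoff i + t) = [Vtx' i, Vtx i, HashV i] ! t" if "i \<in> {1..n}" "t < 3"
  proof -
    have "(i - 1) * 3 + t < n * 3" using that by auto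
    then have "s ! (n * 2 + (m * 2 + ((i - 1) * 3 + t)))
        = h' ! ((i - 1) * 3 + t)"
      unfolding s by (simp add: nth_append L)
    then show ?thesis using N(3) [OF that] by (simp add: h_def xoff_def algebra_simps)
  qed
  show "s ! (yoff j + t) = (case ends j of (p, q) \<Rightarrow>
      [Vtx' p, Vtx p, Edge j, Dollar j, Vtx' q, Vtx q, Edge j, Dollar j, HashE j]) ! t"
    if "j \<in> {1..m}" "t < 9"
  proof -
    have "s ! (n * 2 + (m * 2 + (n * 3 + ((j - 1) * 9 + t))))
        = k' ! ((j - 1) * 9 + t)"
      unfolding s by (simp add: nth_append L)
    then show ?thesis using N(4) [OF that] by (simp add: k_def yoff_def algebra_simps)
  qed
qed

lemma nth_s_occ: "occ p c \<Longrightarrow> p \<in> {1..length s} \<and> s ! (p - 1) = c"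
proof (induction rule: occ.induct)
  case (PV i)
  then show ?case using nth_s(1) [of i 0] by (auto simp: length_s algebra_simps)
next
  case (PVH i)
  then have "(i - 1) * 2 + 1 = 2 * i - 1" by auto
  with PVH show ?case using nth_s(1) [of i 1] by (auto simp: length_s)
next
  case (PE j)
  then have "2 * n + (j - 1) * 2 + 0 = 2 * n + 2 * j - 1 - 1" by auto
  with PE show ?case using nth_s(2) [of j 0] by (auto simp: length_s)
next
  case (PEH j)
  then have "2 * n + (j - 1) * 2 + 1 = 2 * n + 2 * j - 1" by auto
  with PEH show ?case using nth_s(2) [of j 1] by (auto simp: length_s)
next
  case (X1 i)
  then show ?case using nth_s(3) [of i 0] by (auto simp: length_s xoff_def)
next
  case (X2 i)
  then show ?case using nth_s(3) [of i 1] by (auto simp: length_s xoff_def)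
next
  case (X3 i)
  then show ?case using nth_s(3) [of i 2] by (auto simp: length_s xoff_def add.assoc)
next
  case (Y1 j)
  then show ?case using nth_s(4) [of j 0] by (auto simp: length_s yoff_def case_prod_beta ac_simps)
next
  case (Y2 j)
  then show ?case using nth_s(4) [of j 1] by (auto simp: length_s yoff_def case_prod_beta ac_simps)
next
  case (Y3 j)
  then show ?case using nth_s(4) [of j 2] by (auto simp: length_s yoff_def case_prod_beta ac_simps)
next
  case (Y4 j)
  then show ?case using nth_s(4) [of j 3] by (auto simp: length_s yoff_def case_prod_beta ac_simps)
next
  case (Y5 j)
  then show ?case using nth_s(4) [of j 4] by (auto simp: length_s yoff_def case_prod_beta ac_simps)
next
  case (Y6 j)
  then show ?case using nth_s(4) [of j 5] by (auto simp: length_s yoff_def case_prod_beta ac_simps)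
next
  case (Y7 j)
  then show ?case using nth_s(4) [of j 6] by (auto simp: length_s yoff_def case_prod_beta ac_simps)
next
  case (Y8 j)
  then show ?case using nth_s(4) [of j 7] by (auto simp: length_s yoff_def case_prod_beta ac_simps)
next
  case (Y9 j)
  then show ?case using nth_s(4) [of j 8] by (auto simp: length_s yoff_def case_prod_beta ac_simps)
qed

lemma occ_total:
  assumes "p \<in> {1..length s}"
  shows "\<exists>c. occ p c"
proof -
  \<comment> \<open>The two halves of \<open>P\<close>, then \<open>X\<close>, then
    \<open>Y\<close>. Subtraction truncates at 0, so a difference of at least 1 also places
    \<open>p\<close> beyond the preceding parts.\<close>
  consider "p \<in> {1..n * 2}" | "p - 2 * n \<in> {1..m * 2}" | "p - 2 * n - 2 * m \<in> {1..n * 3}"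
    | "p - 5 * n - 2 * m \<in> {1..m * 9}"
    using assms unfolding length_s atLeastAtMost_iff by linarith
  then show ?thesis
  proof cases
    case 1
    then obtain i t where i: "i \<in> {1..n}" "t < 2" "p = (i - 1) * 2 + t + 1"
      by (rule block_position)
    then have "t = 0 \<and> p = 2 * i - 1 \<or> t = 1 \<and> p = 2 * i" by auto
    then show ?thesis using i PV PVH by metis
  next
    case 2
    then obtain i t where i: "i \<in> {1..m}" "t < 2" "p - 2 * n = (i - 1) * 2 + t + 1"
      by (rule block_position)
    then have "t = 0 \<and> p = 2 * n + 2 * i - 1 \<or> t = 1 \<and> p = 2 * n + 2 * i" by auto
    then show ?thesis using i PE PEH by metis
  next
    case 3
    then obtain i t where i: "i \<in> {1..n}" "t < 3" "p - 2 * n - 2 * m = (i - 1) * 3 + t + 1"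
      by (rule block_position)
    then have "p = xoff i + 1 \<or> p = xoff i + 2 \<or> p = xoff i + 3" by (auto simp: xoff_def)
    then show ?thesis using i X1 X2 X3 by metis
  next
    case 4
    then obtain i t where i: "i \<in> {1..m}" "t < 9" "p - 5 * n - 2 * m = (i - 1) * 9 + t + 1"
      by (rule block_position)
    then have p: "p = yoff i + Suc t" by (simp add: yoff_def)
    have "t \<in> {0, 1, 2, 3, 4, 5, 6, 7, 8}" using i(2) by auto
    then show ?thesis
      unfolding p using Y1 [OF i(1)] Y2 [OF i(1)] Y3 [OF i(1)] Y4 [OF i(1)] Y5 [OF i(1)]
        Y6 [OF i(1)] Y7 [OF i(1)] Y8 [OF i(1)] Y9 [OF i(1)]
      by (elim insertE emptyE) (auto simp: numeral_eq_Suc)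
  qed
qed

text \<open>The table is correct entry by entry, and it has an entry for every position; a correct
  entry there must be the symbol of the string.\<close>

lemma occ_iff: "occ p c \<longleftrightarrow> p \<in> {1..length s} \<and> s ! (p - 1) = c"
  using nth_s_occ occ_total by blast

lemma occ_unique: "occ p c \<Longrightarrow> occ p c' \<Longrightarrow> c = c'"
  by (simp add: occ_iff)

text \<open>In \<open>P\<close> and \<open>X\<close> a symbol \<open>v_r\<close> is followed by a
  separator, so only the two halves of \<open>Y_j\<close> remain.\<close>

lemma occ_Vtx_Edge:
  assumes "occ p (Vtx r)" "occ (Suc p) (Edge j)"
  shows "p = yoff j + 2 \<and> r = fst (ends j) \<or> p = yoff j + 6 \<and> r = snd (ends j)"
  using assms(1)
proof cases
  case PV
  then have "Suc p = 2 * r" by auto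
  then have "occ (Suc p) (HashP r)" using PVH [of r] PV by simp
  then show ?thesis using occ_unique assms(2) by blast
next
  case X2
  then have "occ (Suc p) (HashV r)" using X3 [of r] by (simp add: numeral_3_eq_3)
  then show ?thesis using occ_unique assms(2) by blast
next
  case (Y2 l)
  then have "occ (Suc p) (Edge l)" using Y3 [of l] by (simp add: numeral_3_eq_3)
  then show ?thesis using occ_unique assms(2) Y2 by blast
next
  case (Y6 l)
  then have "occ (Suc p) (Edge l)" using Y7 [of l] by (simp add: ac_simps)
  then show ?thesis using occ_unique assms(2) Y6 by blast
qed

text \<open>The occurrence of \<open>e_j\<close> in \<open>P\<close> is followed by a
  separator.\<close>

lemma occ_Edge_Dollar:
  assumes "occ p (Edge j)" "occ (Suc p) (Dollar j)"
  shows "p = yoff j + 3 \<or> p = yoff j + 7"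
  using assms(1)
proof cases
  case PE
  then have "Suc p = 2 * n + 2 * j" by auto
  then have "occ (Suc p) (HashP (n + j))" using PEH [of j] PE by simp
  then show ?thesis using occ_unique assms(2) by blast
qed auto

section \<open>From a parsing to a vertex cover\<close>

context
  fixes phs :: "phrase list"
  assumes BLZ: "BLZ_parsing 1 s phs"
begin

abbreviation F :: "nat set" where
  "F \<equiv> finals phs"

text \<open>A first occurrence has nothing to be copied from.\<close>

lemma fresh_final:
  assumes "occ p c" "\<And>q. occ q c \<Longrightarrow> p \<le> q"
  shows "p \<in> F"
proof (rule ccontr)
  assume "p \<notin> F"
  moreover have p: "p \<in> {1..length s}" "s ! (p - 1) = c"
    using assms(1) by (simp_all add: occ_iff)
  ultimately obtain q where "1 \<le> q" "q < p" "s ! (q - 1) = s ! (p - 1)"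
    using nonfinal_occurs [OF BLZ] by metis
  then have "occ q c" using p by (simp add: occ_iff)
  with assms(2) \<open>q < p\<close> show False by force
qed

text \<open>\<open>P\<close> introduces every \<open>v_i\<close> and \<open>e_j\<close>, and its
  separators occur nowhere else.\<close>

lemma P_final:
  assumes "p \<in> {0<..2 * n + 2 * m}"
  shows "p \<in> F"
proof -
  obtain c where c: "occ p c"
    using occ_total [of p] assms by (auto simp: length_s)
  moreover have "p \<le> q" if "occ q c" for q
    using c
  proof cases
    case (PV i) then show ?thesis using that by (auto elim!: occ.cases simp: xoff_def yoff_def)
  next
    case (PVH i) then show ?thesis using that by (auto elim!: occ.cases simp: xoff_def yoff_def)
  next
    case (PE i) then show ?thesis using that by (auto elim!: occ.cases simp: xoff_def yoff_def)
  next
    case (PEH i) then show ?thesis using that by (auto elim!: occ.cases simp: xoff_def yoff_def)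
  qed (use assms in \<open>auto simp: xoff_def yoff_def\<close>)
  ultimately show ?thesis by (rule fresh_final)
qed

lemma X1_final: "i \<in> {1..n} \<Longrightarrow> xoff i + 1 \<in> F"
  by (rule fresh_final [OF X1]) (auto elim!: occ.cases simp: xoff_def yoff_def)

lemma X3_final: "i \<in> {1..n} \<Longrightarrow> xoff i + 3 \<in> F"
  by (rule fresh_final [OF X3]) (auto elim!: occ.cases)

lemma Y4_final: "j \<in> {1..m} \<Longrightarrow> yoff j + 4 \<in> F"
  by (rule fresh_final [OF Y4]) (auto elim!: occ.cases)

lemma Y9_final: "j \<in> {1..m} \<Longrightarrow> yoff j + 9 \<in> F"
  by (rule fresh_final [OF Y9]) (auto elim!: occ.cases)

text \<open>The block before \<open>Y_j\<close>, which is \<open>X_n\<close> or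
  \<open>Y_{j-1}\<close>, ends with a fresh separator. So a copy at the start of \<open>Y_j\<close>
  begins a new phrase, as \<open>final_source_pair\<close> requires.\<close>

lemma Y0_final:
  assumes j: "j \<in> {1..m}"
  shows "yoff j \<in> F"
proof (cases "j = 1")
  case True
  \<comment> \<open>The endpoints of an edge witness that there is at least one vertex.\<close>
  have n: "n \<in> {1..n}" using ends [OF j] by auto
  then have "xoff n + 3 = yoff j"
    unfolding xoff_def yoff_def True by auto
  then show ?thesis using X3_final [OF n] by simp
next
  case False
  with j have "yoff (j - 1) + 9 = yoff j" "j - 1 \<in> {1..m}"
    unfolding yoff_def by auto
  then show ?thesis using Y9_final [of "j - 1"] by simp
qed

text \<open>If both were copied, the pair would occur in both halves of \<open>Y_j\<close>, and the
  two endpoints would coincide.\<close>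

lemma Vtx_Edge_final:
  assumes p: "occ p (Vtx r)" "occ (Suc p) (Edge j)"
  shows "p \<in> F \<or> Suc p \<in> F"
proof (rule ccontr)
  assume "\<not> ?thesis"
  then obtain q where q: "1 \<le> q" "q < p" "s ! (q - 1) = s ! (p - 1)" "s ! q = s ! p"
    using nonfinal2_occurs [OF BLZ, of p] p(1) by (auto simp: occ_iff)
  then have "occ q (Vtx r)" "occ (Suc q) (Edge j)"
    using p by (auto simp: occ_iff)
  then have "yoff j + 2 = q \<and> r = fst (ends j) \<and> yoff j + 6 = p \<and> r = snd (ends j)"
    using occ_Vtx_Edge [of q r j] occ_Vtx_Edge [OF p] q(2) by auto
  moreover have "j \<in> {1..m}"
    using p(2) by cases auto
  ultimately show False
    using ends [of j] by simp
qed

lemma Y23_final: "j \<in> {1..m} \<Longrightarrow> yoff j + 2 \<in> F \<or> yoff j + 3 \<in> F"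
  using Vtx_Edge_final [OF Y2, of j j] Y3 [of j] by (simp add: numeral_3_eq_3)

lemma Y67_final: "j \<in> {1..m} \<Longrightarrow> yoff j + 6 \<in> F \<or> yoff j + 7 \<in> F"
  using Vtx_Edge_final [OF Y6, of j j] Y7 [of j] by (simp add: ac_simps)

lemma final_source_pair:
  assumes "p \<in> F" "Suc p \<notin> F" "Suc (Suc p) \<notin> F"
    and c: "occ (Suc p) c" "occ (Suc (Suc p)) c'" "c \<noteq> c'"
  obtains q where "Suc q \<le> p" "q \<in> F" "Suc q \<in> F" "occ q c" "occ (Suc q) c'"
proof -
  have "Suc p \<in> {1..length s}" "s ! p \<noteq> s ! Suc p"
    using c by (auto simp: occ_iff)
  then obtain q where "1 \<le> q" "Suc q \<le> p" "q \<in> F" "Suc q \<in> F"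
      "s ! (q - 1) = s ! p" "s ! q = s ! Suc p"
    using nonfinal2_final_source [OF BLZ, of p] assms(1-3) by metis
  with that c show thesis
    by (auto simp: occ_iff)
qed

section \<open>The vertices paid for by extra phrases\<close>

definition X_cover :: "nat set" where
  "X_cover = {i \<in> {1..n}. xoff i + 2 \<in> F}"

text \<open>Two adjacent final positions carrying \<open>v_r' v_r\<close> can serve as the source of
  a later copy. The final \<open>v_r'\<close> is a phrase beyond the two forced in its half.\<close>

definition Y_cover :: "nat \<Rightarrow> nat set" where
  "Y_cover j =
     (if yoff j + 1 \<in> F \<and> yoff j + 2 \<in> F then {fst (ends j)} else {}) \<union>
     (if yoff j + 5 \<in> F \<and> yoff j + 6 \<in> F then {snd (ends j)} else {})"

text \<open>A block with more than four phrases pays for an endpoint of its own edge.\<close>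

definition Y_cover' :: "nat \<Rightarrow> nat set" where
  "Y_cover' j =
     (if Y_cover j = {} \<and> card (F \<inter> {yoff j<..yoff j + 9}) > 4 then {fst (ends j)} else Y_cover j)"

definition parse_cover :: "nat set" where
  "parse_cover = X_cover \<union> (\<Union>j\<in>{1..m}. Y_cover' j)"

lemma Y_count:
  "card (F \<inter> {yoff j<..yoff j + 9}) =
     of_bool (yoff j + 1 \<in> F) + of_bool (yoff j + 2 \<in> F) + of_bool (yoff j + 3 \<in> F) +
     of_bool (yoff j + 4 \<in> F) + of_bool (yoff j + 5 \<in> F) + of_bool (yoff j + 6 \<in> F) +
     of_bool (yoff j + 7 \<in> F) + of_bool (yoff j + 8 \<in> F) + of_bool (yoff j + 9 \<in> F)"
proof -
  have "{yoff j<..yoff j + 9} = {yoff j + 1, yoff j + 2, yoff j + 3, yoff j + 4, yoff j + 5,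
      yoff j + 6, yoff j + 7, yoff j + 8, yoff j + 9}"
    by auto
  then show ?thesis
    by (simp add: card_Int_insert del: Int_insert_right)
qed

lemma X_count:
  assumes "i \<in> {1..n}"
  shows "card (F \<inter> {xoff i<..xoff i + 3}) = 2 + of_bool (i \<in> X_cover)"
proof -
  have "{xoff i<..xoff i + 3} = {xoff i + 1, xoff i + 2, xoff i + 3}"
    by auto
  then show ?thesis
    using X1_final [OF assms] X3_final [OF assms] assms
    by (simp add: card_Int_insert X_cover_def del: Int_insert_right)
qed

text \<open>Forced are offsets 4 and 9, one of 2 and 3, and one of 6 and 7. Each member of
  \<open>Y_cover j\<close> adds offset 1 or 5; the extra case of \<open>Y_cover'\<close> has a fifth
  phrase by definition.\<close>

lemma Y_cover'_count:
  assumes j: "j \<in> {1..m}"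
  shows "4 + card (Y_cover' j) \<le> card (F \<inter> {yoff j<..yoff j + 9})"
proof -
  have "4 + card (Y_cover j) \<le> card (F \<inter> {yoff j<..yoff j + 9})"
    unfolding Y_count Y_cover_def
    using Y4_final [OF j] Y9_final [OF j] Y23_final [OF j] Y67_final [OF j]
    by (auto simp: card_insert_if)
  then show ?thesis
    by (auto simp: Y_cover'_def)
qed

text \<open>\<open>v_r'\<close> occurs only in \<open>X_r\<close> and at the start of halves in
  \<open>Y\<close>, and both definitions of covers were made for these cases.\<close>

lemma final_pair_cover:
  assumes q: "q \<in> F" "Suc q \<in> F" "occ q (Vtx' r)"
  shows "r \<in> parse_cover"
  using q(3)
proof cases
  case X1
  then show ?thesis using q by (auto simp: parse_cover_def X_cover_def)
next
  case (Y1 j)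
  then have "r \<in> Y_cover j" using q by (simp add: Y_cover_def)
  then show ?thesis using Y1 by (auto simp: parse_cover_def Y_cover'_def)
next
  case (Y5 j)
  then have "r \<in> Y_cover j" using q by (simp add: Y_cover_def ac_simps)
  then show ?thesis using Y5 by (auto simp: parse_cover_def Y_cover'_def)
qed

lemma copied_pair_cover:
  assumes "p \<in> F" "Suc p \<notin> F" "Suc (Suc p) \<notin> F"
    and "occ (Suc p) (Vtx' r)" "occ (Suc (Suc p)) (Vtx r)"
  shows "r \<in> parse_cover"
  using final_source_pair [OF assms] final_pair_cover by (metis symbol.distinct(1))

lemma parse_cover_covers:
  assumes j: "j \<in> {1..m}"
  shows "fst (ends j) \<in> parse_cover \<or> snd (ends j) \<in> parse_cover"
proof (cases "Y_cover' j = {}")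
  case False
  moreover have "Y_cover' j \<subseteq> {fst (ends j), snd (ends j)}"
    by (auto simp: Y_cover'_def Y_cover_def split: if_splits)
  ultimately show ?thesis
    using j by (auto simp: parse_cover_def)
next
  case True
  then have e: "Y_cover j = {}" and c: "card (F \<inter> {yoff j<..yoff j + 9}) \<le> 4"
    by (auto simp: Y_cover'_def split: if_splits)
  note f = Y4_final [OF j] Y9_final [OF j] Y23_final [OF j] Y67_final [OF j]
  \<comment> \<open>The four forced ends exhaust the budget, so no other position of the block is
    final.\<close>
  have 1: "yoff j + 1 \<notin> F" "yoff j + 5 \<notin> F" "yoff j + 8 \<notin> F"
    and 2: "yoff j + 2 \<notin> F \<or> yoff j + 3 \<notin> F" "yoff j + 6 \<notin> F \<or> yoff j + 7 \<notin> F"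
    using f c unfolding Y_count by (auto simp: of_bool_def split: if_splits)
  \<comment> \<open>In the first two cases \<open>v' v\<close> is copied in the first or second
    half; in the last one both halves are cut before \<open>e_j\<close>.\<close>
  consider "yoff j + 2 \<notin> F" | "yoff j + 6 \<notin> F"
    | "yoff j + 3 \<notin> F" "yoff j + 6 \<in> F" "yoff j + 7 \<notin> F"
    using 2 by blast
  then show ?thesis
  proof cases
    case 1
    then have "fst (ends j) \<in> parse_cover"
      using copied_pair_cover [OF Y0_final [OF j]] \<open>yoff j + 1 \<notin> F\<close> Y1 [OF j] Y2 [OF j] by simp
    then show ?thesis ..
  next
    case 2
    then have "snd (ends j) \<in> parse_cover"
      using copied_pair_cover [OF Y4_final [OF j]] \<open>yoff j + 5 \<notin> F\<close> Y5 [OF j] Y6 [OF j]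
      by (simp add: ac_simps)
    then show ?thesis ..
  next
    case 3
    \<comment> \<open>Offsets 7 and 8 copy \<open>e_j $_j\<close> from a final pair; the only
      earlier occurrence starts at offset 3, which is not final.\<close>
    have "Suc (yoff j + 6) = yoff j + 7" "Suc (Suc (yoff j + 6)) = yoff j + 8" by simp_all
    then obtain q where q: "Suc q \<le> yoff j + 6" "q \<in> F" "occ q (Edge j)" "occ (Suc q) (Dollar j)"
      using final_source_pair [of "yoff j + 6" "Edge j" "Dollar j"] 3 1 Y7 [OF j] Y8 [OF j]
      by (metis symbol.distinct(31))
    then have "q = yoff j + 3"
      using occ_Edge_Dollar [of q j] by auto
    then show ?thesis using 3 q by simp
  qed
qed

text \<open>The final positions are counted separately: all of \<open>P\<close>, two per
  \<open>X_i\<close> plus one for each member of \<open>X_cover\<close>, and at least four per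
  \<open>Y_j\<close> plus its share of the cover. Overlaps between shares only make the cover
  smaller.\<close>

lemma card_parse_cover: "4 * n + 6 * m + card parse_cover \<le> length phs"
proof -
  have fin: "finite (Y_cover' j)" for j
    by (auto simp: Y_cover'_def Y_cover_def)
  have "card parse_cover \<le> card X_cover + card (\<Union>j\<in>{1..m}. Y_cover' j)"
    unfolding parse_cover_def by (rule card_Un_le)
  also have "card (\<Union>j\<in>{1..m}. Y_cover' j) \<le> (\<Sum>j\<in>{1..m}. card (Y_cover' j))"
    by (rule card_UN_le) simp
  finally have le: "card parse_cover \<le> card X_cover + (\<Sum>j\<in>{1..m}. card (Y_cover' j))"
    by simp
  have "F \<subseteq> {1..length s}"
    using finals_subset [OF BLZ_tiles [OF BLZ]] .
  then have "F = (F \<inter> {0<..2 * n + 2 * m}) \<union> (F \<inter> {2 * n + 2 * m<..2 * n + 2 * m + n * 3})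
      \<union> (F \<inter> {5 * n + 2 * m<..5 * n + 2 * m + m * 9})" (is "_ = ?A \<union> ?B \<union> ?C")
    by (auto simp: length_s)
  then have "card F = card (?A \<union> ?B \<union> ?C)" by simp
  also have "\<dots> = card (?A \<union> ?B) + card ?C"
    by (rule card_Un_disjoint) auto
  also have "card (?A \<union> ?B) = card ?A + card ?B"
    by (rule card_Un_disjoint) auto
  also have "?A = {0<..2 * n + 2 * m}"
    using P_final by auto
  also have "card ?B = (\<Sum>i\<in>{1..n}. card (F \<inter> {xoff i<..xoff i + 3}))"
    unfolding card_blocks by (intro sum.cong refl) (auto simp: xoff_def intro!: arg_cong [of _ _ card])
  also have "\<dots> = (\<Sum>i\<in>{1..n}. 2 + of_bool (i \<in> X_cover))"
    using X_count by (intro sum.cong) auto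
  also have "\<dots> = 2 * n + card X_cover"
    unfolding sum.distrib by (simp add: X_cover_def Int_def)
  also have "card ?C = (\<Sum>j\<in>{1..m}. card (F \<inter> {yoff j<..yoff j + 9}))"
    unfolding card_blocks by (intro sum.cong refl) (auto simp: yoff_def intro!: arg_cong [of _ _ card])
  finally have "length phs = 2 * n + 2 * m + (2 * n + card X_cover)
      + (\<Sum>j\<in>{1..m}. card (F \<inter> {yoff j<..yoff j + 9}))"
    using card_finals [OF BLZ_tiles [OF BLZ]] by simp
  moreover have "(\<Sum>j\<in>{1..m}. 4 + card (Y_cover' j))
      \<le> (\<Sum>j\<in>{1..m}. card (F \<inter> {yoff j<..yoff j + 9}))"
    using Y_cover'_count by (intro sum_mono) auto
  ultimately show ?thesis
    using le by (simp add: sum.distrib)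
qed

lemma parse_cover_subset: "parse_cover \<subseteq> {1..n}"
  using ends by (auto simp: parse_cover_def X_cover_def Y_cover'_def Y_cover_def split: if_splits)

end

section \<open>From a vertex cover to a parsing\<close>

text \<open>A sufficient form of phrase for the construction: the source ends before the phrase
  starts, so \<open>mod\<close> disappears, and it consists of positions in \<open>A\<close>, later
  the set of final positions.\<close>

fun plain :: "nat set \<Rightarrow> phrase \<Rightarrow> bool" where
  "plain A (Phrase a e None) \<longleftrightarrow> a = e"
| "plain A (Phrase a e (Some b)) \<longleftrightarrow> a < e \<and> b + (e - a) \<le> a \<and>
     (\<forall>u<e - a. b + u \<in> A \<and> (\<exists>c. occ (b + u) c \<and> occ (a + u) c))"

lemma plain_2:
  assumes "b < a" "b \<in> A" "occ b c" "occ a c"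
  shows "plain A (Phrase a (a + 1) (Some b))"
  using assms by auto

lemma plain_3:
  assumes "b + 1 < a" "b \<in> A" "occ b c" "occ a c" "b + 1 \<in> A" "occ (b + 1) c'" "occ (a + 1) c'"
  shows "plain A (Phrase a (a + 2) (Some b))"
  using assms by (auto simp: less_2_cases_iff)

lemma plain_BLZ:
  assumes t: "tiles 1 (length s) phs" and p: "\<And>ph. ph \<in> set phs \<Longrightarrow> plain (finals phs) ph"
  shows "BLZ_parsing 1 s phs"
proof (rule BLZ_parsing_1I)
  have "LZ_phrase s ph" if ph: "ph \<in> set phs" for ph
  proof (cases ph)
    case (Phrase a e src)
    show ?thesis
    proof (cases src)
      case None
      then show ?thesis using p [OF ph] Phrase by (simp add: LZ_phrase_def)
    next
      case (Some b)
      then have ae: "a < e" "b + (e - a) \<le> a"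
        and c: "\<And>u. u < e - a \<Longrightarrow> \<exists>c. occ (b + u) c \<and> occ (a + u) c"
        using p [OF ph] Phrase by auto
      have "e \<le> length s"
        using finals_subset [OF t] ph Phrase by force
      moreover have "1 \<le> b"
        using c [of 0] ae by (auto simp: occ_iff)
      moreover have "s ! (b + u - 1) = s ! (a + u - 1)" if "u < e - a" for u
        using c [OF that] by (auto simp: occ_iff)
      ultimately show ?thesis
        using LZ_phrase_copy [of b a e s] ae Phrase Some by simp
    qed
  qed
  then show "LZ_parsing s phs"
    using t by (simp add: LZ_parsing_def parsing_def)
  show "b + t mod (a - b) \<in> finals phs" if "Phrase a e (Some b) \<in> set phs" "t < e - a" for a e b t
  proof -
    have "b + (e - a) \<le> a" "b + t \<in> finals phs"
      using p [OF that(1)] that(2) by auto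
    then show ?thesis using that(2) by simp
  qed
qed

text \<open>For \<open>i \<notin> I\<close> the pair of \<open>v_i\<close> and its separator is one
  phrase, copying \<open>v_i\<close> from position \<open>2 * i - 1\<close> of
  \<open>P\<close>.\<close>

definition cover_X :: "nat set \<Rightarrow> nat \<Rightarrow> phrase list" where
  "cover_X I i = Phrase (xoff i + 1) (xoff i + 1) None #
     (if i \<in> I then [Phrase (xoff i + 2) (xoff i + 2) None, Phrase (xoff i + 3) (xoff i + 3) None]
      else [Phrase (xoff i + 2) (xoff i + 2 + 1) (Some (2 * i - 1))])"

text \<open>With \<open>ends j = (p, q)\<close> the cuts are
  \<open>v_p' v_p e_j | $_j | v_q' v_q | e_j $_j #\<close> if \<open>p \<in> I\<close>, and
  \<open>v_p' v_p | e_j $_j | v_q' v_q e_j | $_j #\<close> otherwise. Copying both symbols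
  \<open>v_r' v_r\<close> from \<open>X_r\<close> requires \<open>r \<in> I\<close>.\<close>

definition cover_Y :: "nat set \<Rightarrow> nat \<Rightarrow> phrase list" where
  "cover_Y I j =
     (if fst (ends j) \<in> I then
       [Phrase (yoff j + 1) (yoff j + 1 + 2) (Some (xoff (fst (ends j)) + 1)),
        Phrase (yoff j + 4) (yoff j + 4) None,
        Phrase (yoff j + 5) (yoff j + 5 + 1) (Some (xoff (snd (ends j)) + 1)),
        Phrase (yoff j + 7) (yoff j + 7 + 2) (Some (yoff j + 3))]
      else
       [Phrase (yoff j + 1) (yoff j + 1 + 1) (Some (xoff (fst (ends j)) + 1)),
        Phrase (yoff j + 3) (yoff j + 3 + 1) (Some (2 * n + 2 * j - 1)),
        Phrase (yoff j + 5) (yoff j + 5 + 2) (Some (xoff (snd (ends j)) + 1)),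
        Phrase (yoff j + 8) (yoff j + 8 + 1) (Some (yoff j + 4))])"

definition cover_parse :: "nat set \<Rightarrow> phrase list" where
  "cover_parse I =
     concat (map (\<lambda>i. [Phrase i i None]) [1..<Suc (2 * n + 2 * m)]) @
     concat (map (cover_X I) [1..<Suc n]) @
     concat (map (cover_Y I) [1..<Suc m])"

lemma set_cover_parse:
  "set (cover_parse I) = (\<lambda>i. Phrase i i None) ` {1..2 * n + 2 * m} \<union>
     (\<Union>i\<in>{1..n}. set (cover_X I i)) \<union> (\<Union>j\<in>{1..m}. set (cover_Y I j))"
  by (auto simp: cover_parse_def atLeastLessThanSuc_atLeastAtMost simp del: upt_Suc)

lemma tiles_cover_parse: "tiles 1 (length s) (cover_parse I)"
proof -
  have "tiles (Suc 0) (0 + (2 * n + 2 * m) * 1)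
      (concat (map (\<lambda>i. [Phrase i i None]) [1..<Suc (2 * n + 2 * m)]))"
    by (rule tiles_blocks) auto
  moreover have "tiles (Suc (2 * n + 2 * m)) (2 * n + 2 * m + n * 3)
      (concat (map (cover_X I) [1..<Suc n]))"
    by (rule tiles_blocks) (auto simp: cover_X_def xoff_def)
  moreover have "tiles (Suc (5 * n + 2 * m)) (5 * n + 2 * m + m * 9)
      (concat (map (cover_Y I) [1..<Suc m]))"
    by (rule tiles_blocks) (auto simp: cover_Y_def yoff_def)
  ultimately have "tiles (Suc 0) (5 * n + 2 * m + m * 9) (cover_parse I)"
    unfolding cover_parse_def by (intro tiles_append) (simp_all del: upt_Suc)
  then show ?thesis
    by (simp add: length_s ac_simps)
qed

lemma length_cover_parse:
  assumes "I \<subseteq> {1..n}"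
  shows "length (cover_parse I) = 4 * n + 6 * m + card I"
proof -
  \<comment> \<open>Stated for every prefix length \<open>r\<close>, with \<open>I\<close>
    restricted accordingly, to make the induction go through.\<close>
  have "length (concat (map (cover_X I) [1..<Suc r])) = 2 * r + card (I \<inter> {1..r})" for r
    by (induction r) (auto simp: cover_X_def atLeastAtMostSuc_conv)
  moreover have "I \<inter> {1..n} = I" using assms by auto
  ultimately have "length (concat (map (cover_X I) [1..<Suc n])) = 2 * n + card I"
    by simp
  moreover have "length (concat (map (cover_Y I) [1..<Suc m])) = m * 4"
    by (rule length_concat_blocks) (simp add: cover_Y_def)
  moreover have "length (concat (map (\<lambda>i. [Phrase i i None]) [1..<Suc (2 * n + 2 * m)]))
      = (2 * n + 2 * m) * 1"
    by (rule length_concat_blocks) simp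
  ultimately show ?thesis
    by (simp add: cover_parse_def del: upt_Suc)
qed

text \<open>These include all positions that \<open>cover_X\<close> and \<open>cover_Y\<close> use
  as sources.\<close>

lemma final_cover_parse:
  shows "p \<in> {1..2 * n + 2 * m} \<Longrightarrow> p \<in> finals (cover_parse I)"
    and "i \<in> {1..n} \<Longrightarrow> xoff i + 1 \<in> finals (cover_parse I)"
    and "i \<in> {1..n} \<Longrightarrow> i \<in> I \<Longrightarrow> xoff i + 2 \<in> finals (cover_parse I)"
    and "j \<in> {1..m} \<Longrightarrow> fst (ends j) \<in> I \<Longrightarrow> yoff j + 3 \<in> finals (cover_parse I)"
    and "j \<in> {1..m} \<Longrightarrow> yoff j + 4 \<in> finals (cover_parse I)"
proof -
  have 1: "final ph \<in> finals (cover_parse I)" if "ph \<in> set (cover_parse I)" for ph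
    using that by blast
  show "p \<in> finals (cover_parse I)" if "p \<in> {1..2 * n + 2 * m}"
    using that 1 [of "Phrase p p None"] by (simp add: set_cover_parse)
  show "xoff i + 1 \<in> finals (cover_parse I)" if "i \<in> {1..n}"
    using that 1 [of "Phrase (xoff i + 1) (xoff i + 1) None"]
    by (force simp: set_cover_parse cover_X_def)
  show "xoff i + 2 \<in> finals (cover_parse I)" if "i \<in> {1..n}" "i \<in> I"
    using that 1 [of "Phrase (xoff i + 2) (xoff i + 2) None"]
    by (force simp: set_cover_parse cover_X_def)
  show "yoff j + 3 \<in> finals (cover_parse I)" if "j \<in> {1..m}" "fst (ends j) \<in> I"
  proof -
    have "Phrase (yoff j + 1) (yoff j + 1 + 2) (Some (xoff (fst (ends j)) + 1)) \<in> set (cover_parse I)"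
      using that by (auto simp: set_cover_parse cover_Y_def)
    from 1 [OF this] show ?thesis by (simp add: numeral_3_eq_3)
  qed
  show "yoff j + 4 \<in> finals (cover_parse I)" if j: "j \<in> {1..m}"
  proof -
    have "\<exists>ph\<in>set (cover_Y I j). final ph = yoff j + 4"
      by (simp add: cover_Y_def)
    then obtain ph where "ph \<in> set (cover_parse I)" "final ph = yoff j + 4"
      unfolding set_cover_parse using j by blast
    with 1 [of ph] show ?thesis by simp
  qed
qed

lemma cover_parse_BLZ:
  assumes I: "\<And>j. j \<in> {1..m} \<Longrightarrow> fst (ends j) \<in> I \<or> snd (ends j) \<in> I"
  shows "BLZ_parsing 1 s (cover_parse I)"
proof (rule plain_BLZ [OF tiles_cover_parse])
  fix ph assume "ph \<in> set (cover_parse I)"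
  then consider i where "ph = Phrase i i None"
    | i where "i \<in> {1..n}" "ph \<in> set (cover_X I i)"
    | j where "j \<in> {1..m}" "ph \<in> set (cover_Y I j)"
    unfolding set_cover_parse by blast
  then show "plain (finals (cover_parse I)) ph"
  proof cases
    case (2 i)
    have "plain (finals (cover_parse I)) (Phrase (xoff i + 2) (xoff i + 2 + 1) (Some (2 * i - 1)))"
    proof (rule plain_2 [OF _ _ PV X2])
      show "2 * i - 1 < xoff i + 2" "2 * i - 1 \<in> finals (cover_parse I)"
        using 2(1) by (auto simp: xoff_def intro!: final_cover_parse(1))
    qed (rule 2(1))+
    then show ?thesis
      using 2(2) by (auto simp: cover_X_def split: if_splits)
  next
    case (3 j)
    note j = 3(1)
    define p q where "p = fst (ends j)" and "q = snd (ends j)"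
    have pq: "p \<in> {1..n}" "q \<in> {1..n}"
      using ends [OF j] by (simp_all add: p_def q_def)
    note Y = Y1 [OF j, folded p_def] Y2 [OF j, folded p_def] Y3 [OF j] Y4 [OF j]
      Y5 [OF j, folded q_def] Y6 [OF j, folded q_def] Y7 [OF j] Y8 [OF j] Y9 [OF j]
    note fin = final_cover_parse [of _ I]
    have lt: "xoff p + 3 \<le> yoff j" "xoff q + 3 \<le> yoff j" "2 * n + 2 * j \<le> yoff j"
      using pq j unfolding xoff_def yoff_def by auto
    show ?thesis
    proof (cases "p \<in> I")
      case True
      have "plain (finals (cover_parse I)) (Phrase (yoff j + 1) (yoff j + 1 + 2) (Some (xoff p + 1)))"
        by (rule plain_3 [OF _ _ X1 _ _ _ _])
          (use lt pq True fin(2,3) [of p] Y(1,2) X2 [of p] in \<open>simp_all\<close>)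
      moreover have "plain (finals (cover_parse I))
          (Phrase (yoff j + 5) (yoff j + 5 + 1) (Some (xoff q + 1)))"
        by (rule plain_2 [OF _ _ X1]) (use lt pq fin(2) [of q] Y(5) in simp_all)
      moreover have "plain (finals (cover_parse I))
          (Phrase (yoff j + 7) (yoff j + 7 + 2) (Some (yoff j + 3)))"
        by (rule plain_3 [OF _ _ Y(3,7)])
          (use True j fin(4,5) [of j] Y(4,8) in \<open>simp_all add: p_def ac_simps\<close>)
      ultimately show ?thesis
        using 3(2) True by (auto simp: cover_Y_def simp flip: p_def q_def simp del: plain.simps(2))
    next
      case False
      \<comment> \<open>The covering property enters here: it makes \<open>v_q\<close> in
        \<open>X_q\<close> final, so the third phrase may copy it.\<close>
      then have q: "q \<in> I" using I [OF j] by (simp add: p_def q_def)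
      have "plain (finals (cover_parse I)) (Phrase (yoff j + 1) (yoff j + 1 + 1) (Some (xoff p + 1)))"
        by (rule plain_2 [OF _ _ X1]) (use lt pq fin(2) [of p] Y(1) in simp_all)
      moreover have "plain (finals (cover_parse I))
          (Phrase (yoff j + 3) (yoff j + 3 + 1) (Some (2 * n + 2 * j - 1)))"
        by (rule plain_2 [OF _ _ PE Y(3)]) (use lt j in \<open>auto intro!: fin(1)\<close>)
      moreover have "plain (finals (cover_parse I))
          (Phrase (yoff j + 5) (yoff j + 5 + 2) (Some (xoff q + 1)))"
        by (rule plain_3 [OF _ _ X1 Y(5) _ _ _])
          (use lt pq q fin(2,3) [of q] Y(6) X2 [of q] in \<open>simp_all add: ac_simps\<close>)
      moreover have "plain (finals (cover_parse I))
          (Phrase (yoff j + 8) (yoff j + 8 + 1) (Some (yoff j + 4)))"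
        by (rule plain_2 [OF _ _ Y(4,8)]) (use j fin(5) [of j] in simp_all)
      ultimately show ?thesis
        using 3(2) False by (auto simp: cover_Y_def simp flip: p_def q_def simp del: plain.simps(2))
    qed
  qed simp
qed

theorem BLZ_parsing_iff_cover:
  assumes "k \<le> n"
  shows "(\<exists>phs. BLZ_parsing 1 s phs \<and> length phs = 4 * n + 6 * m + k) \<longleftrightarrow>
    (\<exists>I\<subseteq>{1..n}. card I = k \<and> (\<forall>j\<in>{1..m}. fst (ends j) \<in> I \<or> snd (ends j) \<in> I))"
    (is "?L \<longleftrightarrow> ?R")
proof
  assume ?L
  then obtain phs where phs: "BLZ_parsing 1 s phs" "length phs = 4 * n + 6 * m + k"
    by blast
  let ?C = "parse_cover phs"
  have C: "?C \<subseteq> {1..n}" "card ?C \<le> k"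
    using parse_cover_subset [OF phs(1)] card_parse_cover [OF phs(1)] phs(2) by simp_all
  \<comment> \<open>The extracted cover may have fewer than \<open>k\<close> elements; supersets
    still cover, and \<open>k \<le> n\<close> leaves room to enlarge it.\<close>
  then obtain I where "?C \<subseteq> I" "I \<subseteq> {1..n}" "card I = k"
    using exists_subset_between [of ?C k "{1..n}"] assms by auto
  then show ?R
    using parse_cover_covers [OF phs(1)] by blast
next
  assume ?R
  then show ?L
    using cover_parse_BLZ length_cover_parse by metis
qed

end

section \<open>Transfer from index sets to the graph\<close>

theorem theorem1:
  fixes V :: "'v set" and E :: "'v set set"
    and n m k :: nat
    and v :: "nat \<Rightarrow> 'v" and e :: "nat \<Rightarrow> 'v set" and ends :: "nat \<Rightarrow> nat \<times> nat"
  assumes "simple_graph V E"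
    and "n = card V" and "m = card E"
    and "bij_betw v {1..n} V" and "bij_betw e {1..m} E"
    and "\<And>i. i \<in> {1..m} \<Longrightarrow>
           (case ends i of (p, q) \<Rightarrow> p \<in> {1..n} \<and> q \<in> {1..n} \<and> e i = {v p, v q})"
    and "k \<le> n"
  shows "(\<exists>C. vertex_cover V E C \<and> card C = k) \<longleftrightarrow>
         (\<exists>phs. BLZ_parsing 1 (string_s1 n m ends) phs \<and> length phs = 4 * n + 6 * m + k)"
proof -
  have e: "fst (ends j) \<in> {1..n}" "snd (ends j) \<in> {1..n}" "e j = {v (fst (ends j)), v (snd (ends j))}"
    if "j \<in> {1..m}" for j
    using assms(6) [OF that] by (auto simp: case_prod_beta)
  interpret reduction n m ends
  proof
    fix j assume j: "j \<in> {1..m}"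
    then have "e j \<in> E" using assms(5) by (auto simp: bij_betw_def)
    then have "card (e j) = 2" using assms(1) by (simp add: simple_graph_def)
    \<comment> \<open>Equal endpoints would make \<open>e j\<close> a singleton.\<close>
    then have "fst (ends j) \<noteq> snd (ends j)" using e(3) [OF j] by auto
    then show "fst (ends j) \<in> {1..n} \<and> snd (ends j) \<in> {1..n} \<and> fst (ends j) \<noteq> snd (ends j)"
      using e [OF j] by simp
  qed
  have inj: "inj_on v {1..n}" and V: "V = v ` {1..n}" and E: "E = e ` {1..m}"
    using assms(4,5) by (auto simp: bij_betw_def)
  \<comment> \<open>Injectivity of \<open>v\<close> lets membership of an endpoint in the image be
    read off its index.\<close>
  have cover: "vertex_cover V E (v ` I) \<longleftrightarrow>
      (\<forall>j\<in>{1..m}. fst (ends j) \<in> I \<or> snd (ends j) \<in> I)" if I: "I \<subseteq> {1..n}" for I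
  proof -
    have "v ` I \<inter> e j \<noteq> {} \<longleftrightarrow> fst (ends j) \<in> I \<or> snd (ends j) \<in> I" if "j \<in> {1..m}" for j
      using inj_on_image_mem_iff [OF inj e(1) [OF that] I]
        inj_on_image_mem_iff [OF inj e(2) [OF that] I] e(3) [OF that] by auto
    then show ?thesis
      using I by (auto simp: vertex_cover_def V E)
  qed
  have "(\<exists>C. vertex_cover V E C \<and> card C = k) \<longleftrightarrow>
      (\<exists>I\<subseteq>{1..n}. vertex_cover V E (v ` I) \<and> card (v ` I) = k)"
    unfolding vertex_cover_def V by (metis subset_image_iff)
  also have "\<dots> \<longleftrightarrow>
      (\<exists>I\<subseteq>{1..n}. card I = k \<and> (\<forall>j\<in>{1..m}. fst (ends j) \<in> I \<or> snd (ends j) \<in> I))"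
    using cover card_image [OF inj_on_subset [OF inj]] by metis
  finally show ?thesis
    using BLZ_parsing_iff_cover [OF assms(7)] by simp
qed

end
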